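(* Let an instance of the Bilevel Knapsack with Interdiction Constraints (BKP) be given, with items sorted so that $p_1/w_1 \ge p_2/w_2 \ge \dots \ge p_n/w_n$. Let $z^*$ be its optimal value and let $x^*\in\{0,1\}^n$ be an optimal leader's solution. If there exists a critical item $c$ in $KP^{LP}(x^* )$, then $z(CRIT_1(c))$ is a valid lower bound on $z^*$, i.e. $z(CRIT_1(c)) \le z^*$.
   Context: **Instance.** There are $n$ items. Item $i\in\{1,\dots,n\}$ has a profit $p_i>0$, a follower weight $w_i>0$ and a leader weight $v_i>0$. The leader's capacity is $C_u$ and the follower's capacity is $C_l$. All data are integers, with $v_i<C_u$ and $w_i<C_l$ for all $i$, $\sum_{i=1}^n v_i>C_u$ and $\sum_{i=1}^n w_i>C_l$. Items are sorted so that $p_1/w_1\ge p_2/w_2\ge\dots\ge p_n/w_n$. **Follower's problem.** For $x\in\{0,1\}^n$ let $S=\{i : x_i=0\}$. $KP(x)$ is the 0-1 knapsack problem of maximizing $\sum_{i=1}^n p_i y_i$ subject to $\sum_{i=1}^n w_i y_i\le C_l$, $y_i\le 1-x_i$ and $y_i\in\{0,1\}$ for all $i$. Its optimal value is $z(KP(x))$. **BKP.** $z^*=\min\{z(KP(x)) : x\in\{0,1\}^n,\ \sum_{i=1}^n v_i x_i\le C_u\}$. An optimal leader's solution $x^*$ is a minimizer. **Critical item.** $KP^{LP}(x)$ is the linear programming relaxation of $KP(x)$ (with $y_i\in\{0,1\}$ replaced by $y_i\in[0,1]$). Its optimal solution is taken to be the greedy one, which packs the items of $S$ in the given order until the capacity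 $C_l$ is exhausted, the last item possibly fractionally. A critical item exists if and only if $\sum_{i\in S}w_i>C_l$. In that case the critical item $c$ is the last item with a strictly positive value in this solution, i.e. the item $c\in S$ with $\sum_{i\in S,\,i<c}w_i<C_l\le\sum_{i\in S,\,i\le c}w_i$. **Model $CRIT_1(c)$**, for an item $c$, with variables $x\in\{0,1\}^n$ and $k\in\{0,1\}^{w_c}$: $$\min \sum_{i=1}^{c-1}p_i(1-x_i)$$ subject to $\sum_{i=1}^n v_ix_i\le C_u$; $\ \sum_{i=1}^{c-1}w_i(1-x_i)+\sum_{j=1}^{w_c}j\,k_j=C_l$; $\ \sum_{j=1}^{w_c}k_j=1$; $\ x_c=0$; $\ x_i\in\{0,1\}$ for $i=1,\dots,n$; $\ k_j\in\{0,1\}$ for $j=1,\dots,w_c$. For a model $M$, $z(M)$ denotes its optimal value. *)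

theory Defs
  imports "HOL-Library.FuncSet" "HOL-Library.Extended_Real"
begin

text \<open>
  Items are the numbers \<open>1, \<dots>, n\<close>. All data are integers. A vector indexed by a set \<open>I\<close> is
  an extensional function on \<open>I\<close>, so the sets of 0-1 vectors below are finite. Optimal values are
  suprema or infima in \<open>ereal\<close>: they are attained whenever the problem is feasible, and an
  infeasible minimization problem has value \<open>\<infinity>\<close>.
\<close>

definition bkp_instance ::
  "nat \<Rightarrow> (nat \<Rightarrow> int) \<Rightarrow> (nat \<Rightarrow> int) \<Rightarrow> (nat \<Rightarrow> int) \<Rightarrow> int \<Rightarrow> int \<Rightarrow> bool" where
  "bkp_instance n p w v Cu Cl \<longleftrightarrow>
     (\<forall>i\<in>{1..n}. 0 < p i \<and> 0 < w i \<and> 0 < v i) \<and>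
     (\<forall>i\<in>{1..n}. v i < Cu \<and> w i < Cl) \<and>
     Cu < (\<Sum>i=1..n. v i) \<and> Cl < (\<Sum>i=1..n. w i) \<and>
     (\<forall>i\<in>{1..n}. \<forall>j\<in>{1..n}. i \<le> j \<longrightarrow>
        real_of_int (p j) / real_of_int (w j) \<le> real_of_int (p i) / real_of_int (w i))"

definition binary_vectors :: "'i set \<Rightarrow> ('i \<Rightarrow> int) set" where
  "binary_vectors I = I \<rightarrow>\<^sub>E {0, 1}"

definition kp_feasible :: "nat \<Rightarrow> (nat \<Rightarrow> int) \<Rightarrow> int \<Rightarrow> (nat \<Rightarrow> int) \<Rightarrow> (nat \<Rightarrow> int) set" where
  "kp_feasible n w Cl x =
     {y \<in> binary_vectors {1..n}. (\<Sum>i=1..n. w i * y i) \<le> Cl \<and> (\<forall>i\<in>{1..n}. y i \<le> 1 - x i)}"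

definition z_kp ::
  "nat \<Rightarrow> (nat \<Rightarrow> int) \<Rightarrow> (nat \<Rightarrow> int) \<Rightarrow> int \<Rightarrow> (nat \<Rightarrow> int) \<Rightarrow> ereal" where
  "z_kp n p w Cl x =
     (SUP y\<in>kp_feasible n w Cl x. ereal (real_of_int (\<Sum>i=1..n. p i * y i)))"

definition leader_feasible :: "nat \<Rightarrow> (nat \<Rightarrow> int) \<Rightarrow> int \<Rightarrow> (nat \<Rightarrow> int) set" where
  "leader_feasible n v Cu = {x \<in> binary_vectors {1..n}. (\<Sum>i=1..n. v i * x i) \<le> Cu}"

definition z_bkp ::
  "nat \<Rightarrow> (nat \<Rightarrow> int) \<Rightarrow> (nat \<Rightarrow> int) \<Rightarrow> (nat \<Rightarrow> int) \<Rightarrow> int \<Rightarrow> int \<Rightarrow> ereal" where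
  "z_bkp n p w v Cu Cl = (INF x\<in>leader_feasible n v Cu. z_kp n p w Cl x)"

definition optimal_leader_solution ::
  "nat \<Rightarrow> (nat \<Rightarrow> int) \<Rightarrow> (nat \<Rightarrow> int) \<Rightarrow> (nat \<Rightarrow> int) \<Rightarrow> int \<Rightarrow> int \<Rightarrow> (nat \<Rightarrow> int) \<Rightarrow> bool" where
  "optimal_leader_solution n p w v Cu Cl x \<longleftrightarrow>
     x \<in> leader_feasible n v Cu \<and> z_kp n p w Cl x = z_bkp n p w v Cu Cl"

definition follower_items :: "nat \<Rightarrow> (nat \<Rightarrow> int) \<Rightarrow> nat set" where
  "follower_items n x = {i \<in> {1..n}. x i = 0}"

definition kp_lp_feasible :: "nat \<Rightarrow> (nat \<Rightarrow> int) \<Rightarrow> int \<Rightarrow> (nat \<Rightarrow> int) \<Rightarrow> (nat \<Rightarrow> real) set" where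
  "kp_lp_feasible n w Cl x =
     {y \<in> {1..n} \<rightarrow>\<^sub>E {0..1}. (\<Sum>i=1..n. real_of_int (w i) * y i) \<le> real_of_int Cl \<and>
        (\<forall>i\<in>{1..n}. y i \<le> 1 - real_of_int (x i))}"

text \<open>
  The greedy solution gives an available item \<open>i\<close> the fraction (at most 1) of it that fits into
  what the available items before \<open>i\<close> leave of the capacity. Lemma \<open>kp_lp_greedy_optimal\<close> below
  shows that it is an optimal solution of the relaxation.
\<close>

definition kp_lp_greedy :: "nat \<Rightarrow> (nat \<Rightarrow> int) \<Rightarrow> int \<Rightarrow> (nat \<Rightarrow> int) \<Rightarrow> nat \<Rightarrow> real" where
  "kp_lp_greedy n w Cl x = (\<lambda>i\<in>{1..n}.
     if i \<in> follower_items n x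
     then max 0 (min 1 (real_of_int (Cl - (\<Sum>j\<in>{j \<in> follower_items n x. j < i}. w j))
                        / real_of_int (w i)))
     else 0)"

definition critical_item :: "nat \<Rightarrow> (nat \<Rightarrow> int) \<Rightarrow> int \<Rightarrow> (nat \<Rightarrow> int) \<Rightarrow> nat \<Rightarrow> bool" where
  "critical_item n w Cl x c \<longleftrightarrow>
     Cl < (\<Sum>i\<in>follower_items n x. w i) \<and>
     c \<in> {1..n} \<and> 0 < kp_lp_greedy n w Cl x c \<and>
     (\<forall>i\<in>{1..n}. 0 < kp_lp_greedy n w Cl x i \<longrightarrow> i \<le> c)"

definition crit1_feasible ::
  "nat \<Rightarrow> (nat \<Rightarrow> int) \<Rightarrow> (nat \<Rightarrow> int) \<Rightarrow> int \<Rightarrow> int \<Rightarrow> nat \<Rightarrow> ((nat \<Rightarrow> int) \<times> (int \<Rightarrow> int)) set" where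
  "crit1_feasible n w v Cu Cl c =
     {(x, k). x \<in> binary_vectors {1..n} \<and> k \<in> binary_vectors {1..w c} \<and>
        (\<Sum>i=1..n. v i * x i) \<le> Cu \<and>
        (\<Sum>i=1..<c. w i * (1 - x i)) + (\<Sum>j=1..w c. j * k j) = Cl \<and>
        (\<Sum>j=1..w c. k j) = 1 \<and>
        x c = 0}"

definition z_crit1 ::
  "nat \<Rightarrow> (nat \<Rightarrow> int) \<Rightarrow> (nat \<Rightarrow> int) \<Rightarrow> (nat \<Rightarrow> int) \<Rightarrow> int \<Rightarrow> int \<Rightarrow> nat \<Rightarrow> ereal" where
  "z_crit1 n p w v Cu Cl c =
     (INF (x, k)\<in>crit1_feasible n w v Cu Cl c.
        ereal (real_of_int (\<Sum>i=1..<c. p i * (1 - x i))))"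

lemma critical_item_iff:
  assumes w: "\<forall>i\<in>{1..n}. 0 < w i"
  shows "critical_item n w Cl x c \<longleftrightarrow>
     Cl < (\<Sum>i\<in>follower_items n x. w i) \<and>
     c \<in> follower_items n x \<and>
     (\<Sum>i\<in>{i \<in> follower_items n x. i < c}. w i) < Cl \<and>
     Cl \<le> (\<Sum>i\<in>{i \<in> follower_items n x. i \<le> c}. w i)"
proof -
  define S where "S = follower_items n x"
  have fin: "finite S" and S: "S \<subseteq> {1..n}" by (auto simp: S_def follower_items_def)
  have wS: "0 < w i" if "i \<in> S" for i using that S w by auto
  have pos: "0 < kp_lp_greedy n w Cl x i \<longleftrightarrow> i \<in> S \<and> (\<Sum>j\<in>{j \<in> S. j < i}. w j) < Cl"
    if "i \<in> {1..n}" for i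
  proof -
    have wi: "0 < real_of_int (w i)" using that w by auto
    show ?thesis
      unfolding kp_lp_greedy_def S_def[symmetric] using that wi
      by (simp add: less_max_iff_disj zero_less_divide_iff del: of_int_diff of_int_sum)
  qed
  have mono: "(\<Sum>j\<in>A. w j) \<le> (\<Sum>j\<in>B. w j)" if "A \<subseteq> B" "B \<subseteq> S" for A B
    using that wS finite_subset[OF that(2) fin] by (intro sum_mono2) (auto intro: less_imp_le)
  show ?thesis
  proof (intro iffI)
    assume c: "critical_item n w Cl x c"
    have big: "Cl < sum w S" using c by (simp add: critical_item_def S_def)
    have cS: "c \<in> S" and lt: "(\<Sum>j\<in>{j \<in> S. j < c}. w j) < Cl"
      using c pos[of c] by (auto simp: critical_item_def)
    have "Cl \<le> (\<Sum>i\<in>{i \<in> S. i \<le> c}. w i)"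
    proof (cases "\<exists>i\<in>S. c < i")
      case True
      define d where "d = Min {i \<in> S. c < i}"
      have "d \<in> {i \<in> S. c < i}" unfolding d_def using True fin by (intro Min_in) auto
      then have d: "d \<in> S" "c < d" by auto
      have least: "d \<le> i" if "i \<in> S" "c < i" for i
        unfolding d_def using that fin by (intro Min_le) auto
      have eq: "{j \<in> S. j < d} = {i \<in> S. i \<le> c}"
        using d least by force
      have "\<not> 0 < kp_lp_greedy n w Cl x d"
        using c d S by (auto simp: critical_item_def)
      then show ?thesis using pos[of d] d S eq by auto
    next
      case False
      then have "{i \<in> S. i \<le> c} = S" by force
      then show ?thesis using big by simp
    qed
    then show "Cl < (\<Sum>i\<in>follower_items n x. w i) \<and> c \<in> follower_items n x \<and>
     (\<Sum>i\<in>{i \<in> follower_items n x. i < c}. w i) < Cl \<and>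
     Cl \<le> (\<Sum>i\<in>{i \<in> follower_items n x. i \<le> c}. w i)"
      using big cS lt by (simp add: S_def)
  next
    assume "Cl < (\<Sum>i\<in>follower_items n x. w i) \<and> c \<in> follower_items n x \<and>
     (\<Sum>i\<in>{i \<in> follower_items n x. i < c}. w i) < Cl \<and>
     Cl \<le> (\<Sum>i\<in>{i \<in> follower_items n x. i \<le> c}. w i)"
    then have big: "Cl < sum w S" and cS: "c \<in> S" and lt: "(\<Sum>j\<in>{j \<in> S. j < c}. w j) < Cl"
      and ge: "Cl \<le> (\<Sum>i\<in>{i \<in> S. i \<le> c}. w i)" by (auto simp: S_def)
    have "i \<le> c" if i: "i \<in> {1..n}" "0 < kp_lp_greedy n w Cl x i" for i
    proof (rule ccontr)
      assume "\<not> i \<le> c"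
      then have "(\<Sum>i\<in>{i \<in> S. i \<le> c}. w i) \<le> (\<Sum>j\<in>{j \<in> S. j < i}. w j)"
        by (intro mono) auto
      then show False using pos[of i] i ge by auto
    qed
    then show "critical_item n w Cl x c"
      using big cS lt pos[of c] S by (auto simp: critical_item_def S_def)
  qed
qed

lemma kp_lp_greedy_weight:
  assumes w: "\<forall>i\<in>{1..n}. 0 < w i" and Cl: "0 \<le> Cl" and "m \<le> n"
  shows "(\<Sum>i=1..m. real_of_int (w i) * kp_lp_greedy n w Cl x i)
         = min (real_of_int Cl) (real_of_int (\<Sum>i\<in>{i \<in> follower_items n x. i \<le> m}. w i))"
  using \<open>m \<le> n\<close>
proof (induction m)
  case 0
  have "{i \<in> follower_items n x. i \<le> 0} = {}" by (auto simp: follower_items_def)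
  then show ?case using Cl by (simp only:) simp
next
  case (Suc m)
  define S where "S = follower_items n x"
  define W where "W = (\<Sum>i\<in>{i \<in> S. i \<le> m}. w i)"
  have fin: "finite S" by (auto simp: S_def follower_items_def)
  have wp: "0 < real_of_int (w (Suc m))" using w Suc.prems by auto
  have IH: "(\<Sum>i=1..m. real_of_int (w i) * kp_lp_greedy n w Cl x i) = min (real_of_int Cl) (real_of_int W)"
    using Suc by (simp add: W_def S_def)
  have less: "{j \<in> S. j < Suc m} = {i \<in> S. i \<le> m}" by auto
  show ?case
  proof (cases "Suc m \<in> S")
    case True
    have eq: "{i \<in> S. i \<le> Suc m} = insert (Suc m) {i \<in> S. i \<le> m}"
      using True by (auto simp: le_Suc_eq)
    have sum: "(\<Sum>i\<in>{i \<in> S. i \<le> Suc m}. w i) = w (Suc m) + W"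
      unfolding eq W_def using fin by (subst sum.insert) auto
    have g: "kp_lp_greedy n w Cl x (Suc m) =
        max 0 (min 1 ((real_of_int Cl - real_of_int W) / real_of_int (w (Suc m))))"
      using True Suc.prems unfolding kp_lp_greedy_def S_def[symmetric]
      by (simp add: less W_def[symmetric] del: of_int_sum less_Suc_eq_le)
    have "real_of_int (w (Suc m)) * kp_lp_greedy n w Cl x (Suc m)
        = max 0 (min (real_of_int (w (Suc m))) (real_of_int Cl - real_of_int W))"
      unfolding g using wp by (simp add: max_mult_distrib_left min_mult_distrib_left)
    then show ?thesis using IH wp unfolding S_def[symmetric] sum by simp
  next
    case False
    have eq: "{i \<in> S. i \<le> Suc m} = {i \<in> S. i \<le> m}"
      using False by (auto simp: le_Suc_eq)
    have "kp_lp_greedy n w Cl x (Suc m) = 0"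
      using False Suc.prems by (simp add: kp_lp_greedy_def S_def)
    then show ?thesis using IH unfolding S_def[symmetric] eq W_def by simp
  qed
qed

lemma kp_lp_greedy_optimal:
  assumes inst: "bkp_instance n p w v Cu Cl" and "0 \<le> Cl" and x: "x \<in> binary_vectors {1..n}"
  shows "kp_lp_greedy n w Cl x \<in> kp_lp_feasible n w Cl x"
    and "y \<in> kp_lp_feasible n w Cl x \<Longrightarrow>
      (\<Sum>i=1..n. real_of_int (p i) * y i) \<le> (\<Sum>i=1..n. real_of_int (p i) * kp_lp_greedy n w Cl x i)"
proof -
  define S where "S = follower_items n x"
  define g where "g = kp_lp_greedy n w Cl x"
  have fin: "finite S" and S: "S \<subseteq> {1..n}" by (auto simp: S_def follower_items_def)
  have w: "\<forall>i\<in>{1..n}. 0 < w i" and p: "\<forall>i\<in>{1..n}. 0 < p i"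
    using inst by (auto simp: bkp_instance_def)
  have x01: "i \<notin> S \<longleftrightarrow> x i = 1" "x i = 0 \<or> x i = 1" if "i \<in> {1..n}" for i
    using x that by (fastforce simp: binary_vectors_def S_def follower_items_def)+
  have Sn: "{i \<in> S. i \<le> n} = S" using S by auto
  have weight: "(\<Sum>i=1..n. real_of_int (w i) * g i) = min (real_of_int Cl) (real_of_int (sum w S))"
    using kp_lp_greedy_weight[OF w \<open>0 \<le> Cl\<close> order_refl, of x] Sn by (simp add: g_def S_def)
  have g0: "g i = 0" if "i \<in> {1..n}" "i \<notin> S" for i
    using that by (simp add: g_def kp_lp_greedy_def S_def)
  have gS: "g i = max 0 (min 1 (real_of_int (Cl - (\<Sum>j\<in>{j \<in> S. j < i}. w j)) / real_of_int (w i)))"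
    if "i \<in> S" for i
    using that S by (auto simp: g_def kp_lp_greedy_def S_def[symmetric])
  have g01: "0 \<le> g i \<and> g i \<le> 1" if "i \<in> {1..n}" for i
    using g0[of i] gS[of i] that by (cases "i \<in> S") auto
  have "g \<in> {1..n} \<rightarrow>\<^sub>E {0..1}" using g01 by (auto simp: g_def kp_lp_greedy_def)
  moreover have "g i \<le> 1 - real_of_int (x i)" if "i \<in> {1..n}" for i
    using x01[OF that] g0[OF that] g01[OF that] by auto
  ultimately show "kp_lp_greedy n w Cl x \<in> kp_lp_feasible n w Cl x"
    using weight unfolding g_def[symmetric] kp_lp_feasible_def by auto
  assume y: "y \<in> kp_lp_feasible n w Cl x"
  have y01: "0 \<le> y i" "y i \<le> 1" if "i \<in> {1..n}" for i
    using y that by (auto simp: kp_lp_feasible_def)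
  have y0: "y i = 0" if "i \<in> {1..n}" "i \<notin> S" for i
    using y that x01[of i] y01[of i] by (force simp: kp_lp_feasible_def)
  have ycap: "(\<Sum>i=1..n. real_of_int (w i) * y i) \<le> real_of_int Cl"
    using y by (simp add: kp_lp_feasible_def)
  have mono: "(\<Sum>j\<in>A. w j) \<le> (\<Sum>j\<in>B. w j)" if "A \<subseteq> B" "B \<subseteq> S" for A B
  proof (rule sum_mono2)
    show "finite B" using finite_subset[OF that(2) fin] .
    show "0 \<le> w b" if "b \<in> B - A" for b
      using that \<open>B \<subseteq> S\<close> S w by (meson DiffD1 less_imp_le subsetD)
  qed (use that in auto)
  have full: "g i = 1" if i: "i \<in> S" "(\<Sum>j\<in>{j \<in> S. j \<le> i}. w j) \<le> Cl" for i
  proof -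
    have "{j \<in> S. j \<le> i} = insert i {j \<in> S. j < i}" using i by auto
    then have "w i + (\<Sum>j\<in>{j \<in> S. j < i}. w j) \<le> Cl" using i fin by simp
    then have "real_of_int (w i) \<le> real_of_int (Cl - (\<Sum>j\<in>{j \<in> S. j < i}. w j))"
      by linarith
    moreover have "0 < real_of_int (w i)" using i S w by auto
    ultimately have "1 \<le> real_of_int (Cl - (\<Sum>j\<in>{j \<in> S. j < i}. w j)) / real_of_int (w i)"
      by (simp add: le_divide_eq)
    then show ?thesis using gS[OF i(1)] by simp
  qed
  have "(\<Sum>i=1..n. real_of_int (p i) * y i) \<le> (\<Sum>i=1..n. real_of_int (p i) * g i)"
  proof (cases "sum w S \<le> Cl")
    case True
    have "g i = 1" if "i \<in> S" for i
      using full[OF that] mono[of "{j \<in> S. j \<le> i}" S] True by force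
    then have "y i \<le> g i" if "i \<in> {1..n}" for i
      using that y0 g0 y01 by (cases "i \<in> S") auto
    then show ?thesis using p by (intro sum_mono mult_left_mono) (auto intro: less_imp_le)
  next
    case False
    define T where "T = {i \<in> S. Cl < (\<Sum>j\<in>{j \<in> S. j \<le> i}. w j)}"
    have Sne: "S \<noteq> {}" using False \<open>0 \<le> Cl\<close> by auto
    have "{j \<in> S. j \<le> Max S} = S" using fin by auto
    then have "Max S \<in> T" using False Max_in[OF fin Sne] by (auto simp: T_def)
    moreover have finT: "finite T" using fin by (simp add: T_def)
    ultimately have "Min T \<in> T" by (intro Min_in) auto
    define c where "c = Min T"
    have cT: "c \<in> S" "Cl < (\<Sum>j\<in>{j \<in> S. j \<le> c}. w j)"
      using \<open>Min T \<in> T\<close> by (auto simp: c_def T_def)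
    have before: "g i = 1" if "i \<in> S" "i < c" for i
    proof (rule full[OF that(1)], rule ccontr)
      assume "\<not> (\<Sum>j\<in>{j \<in> S. j \<le> i}. w j) \<le> Cl"
      then have "i \<in> T" using that by (simp add: T_def)
      then have "c \<le> i" unfolding c_def using finT by simp
      then show False using that by simp
    qed
    have after: "g i = 0" if "i \<in> S" "c < i" for i
    proof -
      have "(\<Sum>j\<in>{j \<in> S. j \<le> c}. w j) \<le> (\<Sum>j\<in>{j \<in> S. j < i}. w j)"
        using that by (intro mono) auto
      then have "real_of_int (Cl - (\<Sum>j\<in>{j \<in> S. j < i}. w j)) \<le> 0" using cT by linarith
      moreover have "0 < real_of_int (w i)" using that S w by auto
      ultimately have "real_of_int (Cl - (\<Sum>j\<in>{j \<in> S. j < i}. w j)) / real_of_int (w i) \<le> 0"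
        by (simp add: divide_nonpos_pos)
      then show ?thesis using gS[OF that(1)] by simp
    qed
    define r where "r = real_of_int (p c) / real_of_int (w c)"
    have c: "c \<in> {1..n}" using cT S by auto
    have r0: "0 \<le> r" using p w c by (auto simp: r_def intro!: divide_nonneg_nonneg less_imp_le)
    have rat: "real_of_int (p j) / real_of_int (w j) \<le> real_of_int (p i) / real_of_int (w i)"
      if "i \<in> {1..n}" "j \<in> {1..n}" "i \<le> j" for i j
      using inst that unfolding bkp_instance_def by blast
    have ratio_le: "real_of_int (p i) * (y i - g i) \<le> r * (real_of_int (w i) * (y i - g i))"
      if i: "i \<in> {1..n}" for i
    proof -
      have wi: "0 < real_of_int (w i)" using w i by auto
      consider "i \<notin> S" | "i \<in> S" "i < c" | "i = c" | "i \<in> S" "c < i" by force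
      then show ?thesis
      proof cases
        case 1
        then show ?thesis using y0 g0 i by simp
      next
        case 2
        have "r \<le> real_of_int (p i) / real_of_int (w i)"
          unfolding r_def using 2 by (intro rat i c) auto
        then have "r * real_of_int (w i) \<le> real_of_int (p i)" using wi by (simp add: le_divide_eq)
        moreover have "y i - g i \<le> 0" using before[OF 2] y01[OF i] by simp
        ultimately have "real_of_int (p i) * (y i - g i) \<le> (r * real_of_int (w i)) * (y i - g i)"
          by (rule mult_right_mono_neg)
        then show ?thesis by (simp add: mult.assoc)
      next
        case 3
        then show ?thesis using wi by (simp add: r_def)
      next
        case 4
        have "real_of_int (p i) / real_of_int (w i) \<le> r"
          unfolding r_def using 4 by (intro rat i c) auto
        then have "real_of_int (p i) \<le> r * real_of_int (w i)" using wi by (simp add: divide_le_eq)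
        moreover have "0 \<le> y i - g i" using after[OF 4] y01[OF i] by simp
        ultimately have "real_of_int (p i) * (y i - g i) \<le> (r * real_of_int (w i)) * (y i - g i)"
          by (rule mult_right_mono)
        then show ?thesis by (simp add: mult.assoc)
      qed
    qed
    have capacity: "(\<Sum>i=1..n. real_of_int (w i) * g i) = real_of_int Cl"
      using weight False by (simp add: min_def del: of_int_sum)
    have "(\<Sum>i=1..n. real_of_int (p i) * y i) - (\<Sum>i=1..n. real_of_int (p i) * g i)
        = (\<Sum>i=1..n. real_of_int (p i) * (y i - g i))"
      by (simp add: sum_subtractf right_diff_distrib)
    also have "\<dots> \<le> (\<Sum>i=1..n. r * (real_of_int (w i) * (y i - g i)))"
      by (intro sum_mono ratio_le)
    also have "\<dots> = r * ((\<Sum>i=1..n. real_of_int (w i) * y i) - (\<Sum>i=1..n. real_of_int (w i) * g i))"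
      by (simp add: sum_subtractf right_diff_distrib sum_distrib_left)
    also have "\<dots> \<le> 0"
      using r0 ycap capacity by (intro mult_nonneg_nonpos) auto
    finally show ?thesis by simp
  qed
  then show "(\<Sum>i=1..n. real_of_int (p i) * y i)
      \<le> (\<Sum>i=1..n. real_of_int (p i) * kp_lp_greedy n w Cl x i)"
    by (simp add: g_def)
qed

end

theory Submission
  imports Defs
begin

text \<open>
  Packing every available item before the critical item \<open>c\<close> leaves a residual capacity between \<open>1\<close>
  and \<open>w c\<close>. So the optimal \<open>x\<close>, with \<open>k\<close> selecting this residual, is feasible for \<open>CRIT\<^sub>1(c)\<close>.
  Its objective is the profit of that packing, which the follower can achieve against \<open>x\<close>.
\<close>

text \<open>Translates between the set sums of \<open>critical_item_iff\<close> and the index sums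
  of the model: for binary \<open>x\<close> the factor \<open>1 - x i\<close> is the indicator of
  availability, and \<open>c \<le> n\<close> puts every index below \<open>c\<close> in the range
  where \<open>x\<close> is binary.\<close>

lemma sum_follower_items_before:
  assumes x: "x \<in> binary_vectors {1..n}" and c: "c \<in> {1..n}"
  shows "(\<Sum>i\<in>{i \<in> follower_items n x. i < c}. f i) = (\<Sum>i=1..<c. f i * (1 - x i))"
proof -
  have x01: "x i = 0 \<or> x i = 1" if "i \<in> {1..n}" for i
    using x that by (auto simp: binary_vectors_def)
  show ?thesis
  proof (rule sum.mono_neutral_cong_left)
    show "{i \<in> follower_items n x. i < c} \<subseteq> {1..<c}" by (auto simp: follower_items_def)
    show "\<forall>i\<in>{1..<c} - {i \<in> follower_items n x. i < c}. f i * (1 - x i) = 0"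
      using x01 c by (force simp: follower_items_def)
  qed (auto simp: follower_items_def)
qed

lemma crit1_feasible_residual:
  assumes w: "\<forall>i\<in>{1..n}. 0 < w i" and x: "x \<in> leader_feasible n v Cu"
    and crit: "critical_item n w Cl x c"
  shows "\<exists>k. (x, k) \<in> crit1_feasible n w v Cu Cl c"
proof -
  define B where "B = (\<Sum>i=1..<c. w i * (1 - x i))"
  \<comment> \<open>The unit vector at the residual capacity \<open>Cl - B\<close>; the two sums
    over \<open>k\<close> below each collapse to the single term at that index.\<close>
  define k where "k = (\<lambda>j\<in>{1..w c}. if j = Cl - B then 1 else 0 :: int)"
  have bin: "x \<in> binary_vectors {1..n}" and cap: "(\<Sum>i=1..n. v i * x i) \<le> Cu"
    using x by (auto simp: leader_feasible_def)
  have cS: "c \<in> follower_items n x"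
    and lt: "(\<Sum>i\<in>{i \<in> follower_items n x. i < c}. w i) < Cl"
    and ge: "Cl \<le> (\<Sum>i\<in>{i \<in> follower_items n x. i \<le> c}. w i)"
    using crit critical_item_iff[OF w] by auto
  have c: "c \<in> {1..n}" "x c = 0" using cS by (auto simp: follower_items_def)
  have before: "(\<Sum>i\<in>{i \<in> follower_items n x. i < c}. w i) = B"
    unfolding B_def by (rule sum_follower_items_before[OF bin c(1)])
  have "{i \<in> follower_items n x. i \<le> c} = insert c {i \<in> follower_items n x. i < c}"
    using cS by auto
  moreover have "finite (follower_items n x)" by (simp add: follower_items_def)
  ultimately have "(\<Sum>i\<in>{i \<in> follower_items n x. i \<le> c}. w i) = w c + B"
    using before by simp
  \<comment> \<open>Over the integers the strict bound \<open>lt\<close> gives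
    \<open>Cl - B \<ge> 1\<close>, and \<open>ge\<close> gives \<open>Cl - B \<le> w c\<close>, so
    the residual is an index of \<open>k\<close>.\<close>
  then have residual: "Cl - B \<in> {1..w c}" using lt ge before by simp
  have "(\<Sum>j=1..w c. k j) = (\<Sum>j\<in>{1..w c}. if j = Cl - B then 1 else 0)"
    by (intro sum.cong) (auto simp: k_def)
  also have "\<dots> = 1" using residual by simp
  finally have one: "(\<Sum>j=1..w c. k j) = 1" .
  have "(\<Sum>j=1..w c. j * k j) = (\<Sum>j\<in>{1..w c}. if j = Cl - B then j else 0)"
    by (intro sum.cong) (auto simp: k_def)
  also have "\<dots> = Cl - B" using residual by simp
  finally have "B + (\<Sum>j=1..w c. j * k j) = Cl" by simp
  moreover have "k \<in> binary_vectors {1..w c}" by (auto simp: binary_vectors_def k_def)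
  ultimately have "(x, k) \<in> crit1_feasible n w v Cu Cl c"
    using bin cap c one by (simp add: crit1_feasible_def B_def)
  then show ?thesis by blast
qed

lemma profit_before_le_z_kp:
  assumes x: "x \<in> binary_vectors {1..n}" and c: "c \<in> {1..n}"
    and fits: "(\<Sum>i=1..<c. w i * (1 - x i)) \<le> Cl"
  shows "ereal (real_of_int (\<Sum>i=1..<c. p i * (1 - x i))) \<le> z_kp n p w Cl x"
proof -
  \<comment> \<open>The follower's packing: all available items before \<open>c\<close>, nothing
    from \<open>c\<close> on.\<close>
  define y where "y = (\<lambda>i\<in>{1..n}. if i < c then 1 - x i else 0)"
  have x01: "x i = 0 \<or> x i = 1" if "i \<in> {1..n}" for i
    using x that by (auto simp: binary_vectors_def)
  \<comment> \<open>Kept general in \<open>f\<close>: with \<open>w\<close> it gives the capacity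
    constraint, with \<open>p\<close> the profit.\<close>
  have total: "(\<Sum>i=1..n. f i * y i) = (\<Sum>i=1..<c. f i * (1 - x i))" for f
    using c by (intro sum.mono_neutral_cong_right) (auto simp: y_def)
  have "y \<in> {1..n} \<rightarrow>\<^sub>E {0, 1}" unfolding y_def restrict_PiE_iff
  proof
    show "(if i < c then 1 - x i else 0) \<in> {0, 1}" if "i \<in> {1..n}" for i
      using x01[OF that] by auto
  qed
  moreover have "\<forall>i\<in>{1..n}. y i \<le> 1 - x i" using x01 by (fastforce simp: y_def)
  ultimately have "y \<in> kp_feasible n w Cl x"
    using fits total[of w] by (simp add: kp_feasible_def binary_vectors_def)
  then show ?thesis
    unfolding z_kp_def total[symmetric] by (rule SUP_upper)
qed

theorem proposition1:
  fixes n c :: nat and p w v :: "nat \<Rightarrow> int" and Cu Cl :: int and x :: "nat \<Rightarrow> int"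
  assumes "bkp_instance n p w v Cu Cl"
    and "optimal_leader_solution n p w v Cu Cl x"
    and "critical_item n w Cl x c"
  shows "z_crit1 n p w v Cu Cl c \<le> z_bkp n p w v Cu Cl"
proof -
  have w: "\<forall>i\<in>{1..n}. 0 < w i" using assms(1) by (simp add: bkp_instance_def)
  have x: "x \<in> leader_feasible n v Cu" and opt: "z_kp n p w Cl x = z_bkp n p w v Cu Cl"
    using assms(2) by (auto simp: optimal_leader_solution_def)
  have bin: "x \<in> binary_vectors {1..n}" using x by (simp add: leader_feasible_def)
  have c: "c \<in> {1..n}" using assms(3) by (simp add: critical_item_def)
  have fits: "(\<Sum>i=1..<c. w i * (1 - x i)) \<le> Cl"
    using assms(3) critical_item_iff[OF w] sum_follower_items_before[OF bin c, of w] by auto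
  obtain k where k: "(x, k) \<in> crit1_feasible n w v Cu Cl c"
    using crit1_feasible_residual[OF w x assms(3)] by blast
  \<comment> \<open>The objective does not depend on \<open>k\<close>, so any \<open>k\<close>
    completing \<open>x\<close> to a feasible pair yields this bound on the infimum.\<close>
  have "z_crit1 n p w v Cu Cl c \<le> ereal (real_of_int (\<Sum>i=1..<c. p i * (1 - x i)))"
    unfolding z_crit1_def by (rule INF_lower2[OF k]) simp
  also have "\<dots> \<le> z_kp n p w Cl x" by (rule profit_before_le_z_kp[OF bin c fits])
  \<comment> \<open>Optimality of \<open>x\<close> replaces its follower value by the bilevel
    optimum.\<close>
  finally show ?thesis by (simp add: opt)
qed

end
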